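(* Let $p:[-1,1]\to[1,\infty)$ be continuous. Suppose that $\mathcal J(u^* )\le \mathcal J(u)$ holds for every piecewise linear function $u\in \mathring{W}{}^1_1(-1,1)$ with $u\ge 0$, where $\mathcal J(u)=\int_{-1}^{1}|u'(x)|^{p(x)}\,dx$ and $u^*$ is the symmetrization of $u$. Then $p$ is constant on $[-1,1]$.
   Context: $\mathring{W}{}^1_1(-1,1)$ is the Sobolev space of absolutely continuous functions on $[-1,1]$ with integrable derivative that vanish at $\pm1$. A piecewise linear function is a continuous function that is affine on each interval of some finite partition of $[-1,1]$. For a measurable set $E\subset[-1,1]$ put $E^*=\left[-\frac{|E|}{2},\frac{|E|}{2}\right]$, where $|E|$ is Lebesgue measure. For a nonnegative $u\in\mathring{W}{}^1_1(-1,1)$ put $\mathcal A_t=\{x\in[-1,1]: u(x)>t\}$; the symmetrization (symmetric rearrangement) of $u$ is $u^*(x)=\int_0^\infty \chi_{\mathcal A_t^*}(x)\,dt$, where $\chi$ denotes the characteristic function. *)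

theory Defs
  imports "HOL-Analysis.Analysis"
begin

text \<open>
  A function on the interval \<open>[a, b]\<close> is a total function \<^typ>\<open>real \<Rightarrow> real\<close>
  whose values outside the interval are irrelevant.
\<close>

definition absolutely_continuous_on :: "real set \<Rightarrow> (real \<Rightarrow> real) \<Rightarrow> bool" where
  "absolutely_continuous_on S f \<longleftrightarrow>
     (\<forall>\<epsilon>>0. \<exists>\<delta>>0. \<forall>D T. D division_of T \<and> T \<subseteq> S \<and> (\<Sum>K\<in>D. measure lborel K) < \<delta> \<longrightarrow>
        (\<Sum>K\<in>D. \<bar>f (Sup K) - f (Inf K)\<bar>) < \<epsilon>)"

text \<open>
  \<^const>\<open>deriv\<close> is the derivative almost everywhere; its unspecified value at the points where
  the function is not differentiable, and at \<open>-1\<close> and \<open>1\<close>, does not affect the integrals below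
  because \<^const>\<open>lebesgue\<close> is complete.
\<close>

definition W11_0 :: "(real \<Rightarrow> real) set" where
  "W11_0 = {u. absolutely_continuous_on {-1..1} u \<and>
               set_integrable lebesgue {-1..1} (deriv u) \<and> u (-1) = 0 \<and> u 1 = 0}"

definition piecewise_linear_on :: "real \<Rightarrow> real \<Rightarrow> (real \<Rightarrow> real) \<Rightarrow> bool" where
  "piecewise_linear_on a b u \<longleftrightarrow> continuous_on {a..b} u \<and>
     (\<exists>n (s :: nat \<Rightarrow> real). s 0 = a \<and> s n = b \<and> (\<forall>i<n. s i < s (Suc i)) \<and>
        (\<forall>i<n. \<exists>m c. \<forall>x\<in>{s i..s (Suc i)}. u x = m * x + c))"

text \<open>
  The empty set is its own symmetrization. With \<open>[-0, 0] = {0}\<close> instead, \<open>0\<close> would lie in the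
  symmetrization of every (empty) superlevel set above the maximum of \<open>u\<close>, so that the integral
  defining \<open>u\<^sup>*(0)\<close> would diverge; no other value of \<open>u\<^sup>*\<close> depends on this convention.
\<close>

definition sym_set :: "real set \<Rightarrow> real set" where
  "sym_set E = (if E = {} then {} else {- (measure lebesgue E / 2) .. measure lebesgue E / 2})"

definition superlevel :: "(real \<Rightarrow> real) \<Rightarrow> real \<Rightarrow> real set" where
  "superlevel u t = {x \<in> {-1..1}. u x > t}"

definition symmetrization :: "(real \<Rightarrow> real) \<Rightarrow> real \<Rightarrow> real" where
  "symmetrization u x = (LBINT t:{0..}. indicator (sym_set (superlevel u t)) x)"

text \<open>The integrand is nonnegative, so the functional takes values in \<open>[0, \<infinity>]\<close>.\<close>

definition J :: "(real \<Rightarrow> real) \<Rightarrow> (real \<Rightarrow> real) \<Rightarrow> ennreal" where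
  "J p u = (\<integral>\<^sup>+x\<in>{-1..1}. ennreal (\<bar>deriv u x\<bar> powr p x) \<partial>lebesgue)"

end

theory Submission
  imports Defs
begin

text \<open>
  Test the hypothesis on a tent of slope \<open>s > 0\<close> and half-width \<open>d\<close> centred at \<open>c\<close>. Its
  symmetrization is the same tent centred at \<open>0\<close> (\<open>symmetrization_tent\<close>), and the functional of a tent is the integral of
  \<open>s\<close> to the power \<open>p x\<close> over its base (\<open>J_tent\<close>). The hypothesis therefore compares the means of this power over
  \<open>[-d, d]\<close> and over \<open>[c - d, c + d]\<close>, and \<open>d \<rightarrow> 0\<close> gives \<open>s powr p 0 \<le> s powr p c\<close> for every
  \<open>s > 0\<close> and every \<open>c\<close> in the open interval (\<open>le_if_small_interval_integrals_le\<close>). A slope above \<open>1\<close> yields \<open>p 0 \<le> p c\<close>, a slope below \<open>1\<close> the reverse inequality. So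
  \<open>p\<close> is constant on the open interval, hence by continuity on the closed one.
\<close>

definition tent :: "real \<Rightarrow> real \<Rightarrow> real \<Rightarrow> real \<Rightarrow> real" where
  "tent c d s x = max 0 (s * (d - \<bar>x - c\<bar>))"

lemma tent_eq_0: "0 \<le> s \<Longrightarrow> d \<le> \<bar>x - c\<bar> \<Longrightarrow> tent c d s x = 0"
  by (simp add: tent_def max_absorb1 mult_nonneg_nonpos)

lemma tent_eq: "0 \<le> s \<Longrightarrow> \<bar>x - c\<bar> \<le> d \<Longrightarrow> tent c d s x = s * (d - \<bar>x - c\<bar>)"
  by (simp add: tent_def max_def)

lemma piecewise_linear_on_tent:
  assumes "0 \<le> s" "a < c - d" "0 < d" "c + d < b"
  shows "piecewise_linear_on a b (tent c d s)"
proof -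
  define k :: "nat \<Rightarrow> real" where
    "k i = (if i = 0 then a else if i = 1 then c - d else if i = 2 then c
            else if i = 3 then c + d else b)" for i
  have "\<exists>m q. \<forall>x\<in>{k i..k (Suc i)}. tent c d s x = m * x + q" if "i < 4" for i
  proof -
    have "i = 0 \<or> i = 3 \<or> i = 1 \<or> i = 2"
      using that by linarith
    then consider "i = 0 \<or> i = 3" | "i = 1" | "i = 2"
      by blast
    then show ?thesis
    proof cases
      case 1
      have "\<forall>x\<in>{k i..k (Suc i)}. tent c d s x = 0 * x + 0"
        using 1 assms by (auto simp: k_def intro!: tent_eq_0)
      then show ?thesis by blast
    next
      case 2
      have "\<forall>x\<in>{k i..k (Suc i)}. tent c d s x = s * x + s * (d - c)"
        using 2 assms by (auto simp: k_def tent_eq algebra_simps)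
      then show ?thesis by blast
    next
      case 3
      have "\<forall>x\<in>{k i..k (Suc i)}. tent c d s x = (- s) * x + s * (d + c)"
        using 3 assms by (auto simp: k_def tent_eq algebra_simps)
      then show ?thesis by blast
    qed
  qed
  moreover have "continuous_on {a..b} (tent c d s)"
    unfolding tent_def by (intro continuous_intros)
  moreover have "k 0 = a" "k 4 = b" "\<forall>i<4. k i < k (Suc i)"
    using assms by (auto simp: k_def)
  ultimately show ?thesis
    unfolding piecewise_linear_on_def by blast
qed

lemma lipschitz_imp_absolutely_continuous_on:
  fixes f :: "real \<Rightarrow> real"
  assumes lip: "\<And>x y. x \<in> S \<Longrightarrow> y \<in> S \<Longrightarrow> \<bar>f x - f y\<bar> \<le> L * \<bar>x - y\<bar>" and "0 \<le> L"
  shows "absolutely_continuous_on S f"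
  unfolding absolutely_continuous_on_def
proof (intro allI impI)
  fix e :: real assume "0 < e"
  have "(\<Sum>K\<in>D. \<bar>f (Sup K) - f (Inf K)\<bar>) < e"
    if D: "D division_of T" "T \<subseteq> S" and small: "(\<Sum>K\<in>D. measure lborel K) < e / (L + 1)" for D T
  proof -
    have "\<bar>f (Sup K) - f (Inf K)\<bar> \<le> L * measure lborel K" if "K \<in> D" for K
    proof -
      obtain a b where K: "K = {a..b}"
        using division_ofD(4)[OF D(1) \<open>K \<in> D\<close>] by auto
      have "K \<noteq> {}" "K \<subseteq> S"
        using division_ofD(2,3)[OF D(1) \<open>K \<in> D\<close>] D(2) by auto
      then have "a \<le> b" "a \<in> S" "b \<in> S"
        using K by auto
      then show ?thesis
        using lip[of b a] K by simp
    qed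
    then have "(\<Sum>K\<in>D. \<bar>f (Sup K) - f (Inf K)\<bar>) \<le> L * (\<Sum>K\<in>D. measure lborel K)"
      unfolding sum_distrib_left by (rule sum_mono)
    also have "\<dots> \<le> (L + 1) * (\<Sum>K\<in>D. measure lborel K)"
      by (intro mult_right_mono sum_nonneg) auto
    also have "\<dots> < e"
      using small \<open>0 \<le> L\<close> by (simp add: field_simps)
    finally show ?thesis .
  qed
  moreover have "0 < e / (L + 1)"
    using \<open>0 < e\<close> \<open>0 \<le> L\<close> by simp
  ultimately show "\<exists>\<delta>>0. \<forall>D T. D division_of T \<and> T \<subseteq> S \<and> (\<Sum>K\<in>D. measure lborel K) < \<delta> \<longrightarrow>
      (\<Sum>K\<in>D. \<bar>f (Sup K) - f (Inf K)\<bar>) < e"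
    by blast
qed

lemma tent_lipschitz:
  assumes "0 \<le> s"
  shows "\<bar>tent c d s x - tent c d s y\<bar> \<le> s * \<bar>x - y\<bar>"
proof -
  have "\<bar>tent c d s x - tent c d s y\<bar> \<le> \<bar>s * (d - \<bar>x - c\<bar>) - s * (d - \<bar>y - c\<bar>)\<bar>"
    unfolding tent_def by linarith
  also have "\<dots> = s * \<bar>\<bar>y - c\<bar> - \<bar>x - c\<bar>\<bar>"
    using assms by (simp add: abs_mult flip: right_diff_distrib)
  also have "\<dots> \<le> s * \<bar>x - y\<bar>"
    using assms by (intro mult_left_mono) auto
  finally show ?thesis .
qed

lemma deriv_tent:
  assumes "0 \<le> s" "0 < d" "x \<notin> {c - d, c, c + d}"
  shows "deriv (tent c d s) x = (if \<bar>x - c\<bar> < d then - s * sgn (x - c) else 0)"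
proof -
  consider "d < \<bar>x - c\<bar>" | "c - d < x" "x < c" | "c < x" "x < c + d"
    using assms by fastforce
  then show ?thesis
  proof cases
    case 1
    have "open {y. d < \<bar>y - c\<bar>}"
      by (intro open_Collect_less continuous_intros)
    then have "(tent c d s has_field_derivative 0) (at x)"
      using 1 assms
      by (intro has_field_derivative_transform_within_open[OF DERIV_const[of 0]])
         (auto simp: tent_eq_0)
    then show ?thesis
      using 1 by (simp add: DERIV_imp_deriv)
  next
    case 2
    have "((\<lambda>y. s * (d - (c - y))) has_field_derivative s) (at x)"
      by (auto intro!: derivative_eq_intros)
    then have "(tent c d s has_field_derivative s) (at x)"
      using 2 assms
      by (elim has_field_derivative_transform_within_open[where S = "{c - d<..<c}"])
         (auto simp: tent_eq)
    then show ?thesis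
      using 2 by (simp add: DERIV_imp_deriv)
  next
    case 3
    have "((\<lambda>y. s * (d - (y - c))) has_field_derivative - s) (at x)"
      by (auto intro!: derivative_eq_intros)
    then have "(tent c d s has_field_derivative - s) (at x)"
      using 3 assms
      by (elim has_field_derivative_transform_within_open[where S = "{c<..<c + d}"])
         (auto simp: tent_eq)
    then show ?thesis
      using 3 by (simp add: DERIV_imp_deriv)
  qed
qed

lemma tent_in_W11_0:
  assumes "0 \<le> s" "0 < d" "- 1 \<le> c - d" "c + d \<le> 1"
  shows "tent c d s \<in> W11_0"
proof -
  let ?g = "\<lambda>x. s * indicator {c - d<..<c} x - s * indicator {c<..<c + d} x :: real"
  have "set_integrable lebesgue {-1..1} ?g"
    unfolding set_integrable_def
    by (intro integrable_mult_indicator Bochner_Integration.integrable_diff integrable_mult_right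
        integrable_real_indicator) (use assms in auto)
  then have "set_integrable lebesgue {-1..1} (deriv (tent c d s))"
  proof (rule absolutely_integrable_spike)
    show "negligible {c - d, c, c + d}"
      by simp
    fix x assume "x \<in> {-1..1} - {c - d, c, c + d}"
    then show "deriv (tent c d s) x = ?g x"
      using assms by (auto simp: deriv_tent sgn_if indicator_def)
  qed
  moreover have "absolutely_continuous_on {-1..1} (tent c d s)"
    using assms by (intro lipschitz_imp_absolutely_continuous_on[where L = s] tent_lipschitz)
  ultimately show ?thesis
    using assms by (simp add: W11_0_def tent_eq_0)
qed

text \<open>A tent has slope \<open>\<plusminus>s\<close> on its base and, since \<open>0 powr q = 0\<close>, costs nothing elsewhere.\<close>

lemma J_tent:
  assumes "0 \<le> s" "0 < d" "- 1 \<le> c - d" "c + d \<le> 1"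
  shows "J p (tent c d s) = (\<integral>\<^sup>+x\<in>{c - d..c + d}. ennreal (s powr p x) \<partial>lebesgue)"
  unfolding J_def
proof (rule nn_integral_cong_AE)
  have "{c - d, c, c + d} \<in> null_sets lebesgue"
    by (simp flip: negligible_iff_null_sets)
  then show "AE x in lebesgue. ennreal (\<bar>deriv (tent c d s) x\<bar> powr p x) * indicator {-1..1} x =
      ennreal (s powr p x) * indicator {c - d..c + d} x"
    by (rule AE_mp[OF AE_not_in])
       (use assms in \<open>auto simp: deriv_tent sgn_if indicator_def\<close>)
qed

lemma sym_set_superlevel_tent:
  assumes "0 < s" "0 < d" "- 1 \<le> c - d" "c + d \<le> 1" "0 \<le> t"
  shows "sym_set (superlevel (tent c d s) t) =
    (if t < s * d then {- (d - t / s)..d - t / s} else {})"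
proof -
  define r where "r = d - t / s"
  have above: "tent c d s x > t \<longleftrightarrow> \<bar>x - c\<bar> < r" for x
    using assms by (auto simp: tent_def r_def field_simps)
  have "r \<le> d"
    using assms by (simp add: r_def)
  then have "\<bar>x - c\<bar> < r \<Longrightarrow> x \<in> {-1..1}" for x
    using assms(3,4) unfolding atLeastAtMost_iff by linarith
  then have "superlevel (tent c d s) t = {x. \<bar>x - c\<bar> < r}"
    unfolding superlevel_def above by blast
  also have "\<dots> = {c - r<..<c + r}"
    by (auto simp: abs_less_iff)
  finally have "superlevel (tent c d s) t = {c - r<..<c + r}" .
  moreover have "0 < r \<longleftrightarrow> t < s * d"
    using assms by (simp add: r_def field_simps)
  ultimately show ?thesis
    by (auto simp: sym_set_def simp flip: r_def)
qed

text \<open>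
  The superlevel set at height \<open>t\<close> is an interval of half-width \<open>d - t / s\<close>, whatever the centre
  \<open>c\<close>. Hence the heights at which \<open>x\<close> lies in the symmetrized set fill, up to a null set, the
  interval from \<open>0\<close> to the value at \<open>x\<close> of the tent centred at \<open>0\<close>.
\<close>

lemma symmetrization_tent:
  assumes "0 < s" "0 < d" "- 1 \<le> c - d" "c + d \<le> 1"
  shows "symmetrization (tent c d s) = tent 0 d s"
proof
  fix x
  let ?h = "tent 0 d s x"
  \<comment> \<open>The peak is excluded at \<open>x = 0\<close>: the superlevel set at height \<open>s * d\<close> is empty, and so is its symmetrization.\<close>
  define T where "T = (if x = 0 then {0..<s * d} else {0..s * (d - \<bar>x\<bar>)})"
  have "x \<in> sym_set (superlevel (tent c d s) t) \<longleftrightarrow> t \<in> T" if "0 \<le> t" for t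
  proof -
    have "x \<in> sym_set (superlevel (tent c d s) t) \<longleftrightarrow> t < s * d \<and> t \<le> s * (d - \<bar>x\<bar>)"
    proof -
      have "t \<le> s * (d - \<bar>x\<bar>) \<longleftrightarrow> \<bar>x\<bar> \<le> d - t / s"
        using assms by (simp add: field_simps)
      then show ?thesis
        using assms that by (auto simp: sym_set_superlevel_tent)
    qed
    moreover have "s * (d - \<bar>x\<bar>) < s * d" if "x \<noteq> 0"
      using assms that by simp
    ultimately show ?thesis
      using that by (force simp: T_def)
  qed
  then have "indicator {0..} t * indicator (sym_set (superlevel (tent c d s) t)) x =
      (indicator T t :: real)" for t
    by (cases "0 \<le> t") (auto simp: T_def indicator_def)
  then have "symmetrization (tent c d s) x = measure lborel T"
    by (simp add: symmetrization_def set_lebesgue_integral_def T_def)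
  also have "\<dots> = ?h"
    using assms by (cases "0 \<le> s * (d - \<bar>x\<bar>)") (auto simp: T_def tent_def)
  finally show "symmetrization (tent c d s) x = ?h" .
qed

lemma set_nn_integral_le_const:
  assumes "\<And>x. x \<in> A \<Longrightarrow> f x \<le> k" "A \<in> sets M"
  shows "(\<integral>\<^sup>+x\<in>A. f x \<partial>M) \<le> k * emeasure M A"
proof -
  have "(\<integral>\<^sup>+x\<in>A. f x \<partial>M) \<le> (\<integral>\<^sup>+x. k * indicator A x \<partial>M)"
    using assms(1) by (intro nn_integral_mono) (auto simp: indicator_def)
  then show ?thesis
    using assms(2) by (simp add: nn_integral_cmult_indicator)
qed

lemma const_le_set_nn_integral:
  assumes "\<And>x. x \<in> A \<Longrightarrow> k \<le> f x" "A \<in> sets M"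
  shows "k * emeasure M A \<le> (\<integral>\<^sup>+x\<in>A. f x \<partial>M)"
proof -
  have "(\<integral>\<^sup>+x. k * indicator A x \<partial>M) \<le> (\<integral>\<^sup>+x\<in>A. f x \<partial>M)"
    using assms(1) by (intro nn_integral_mono) (auto simp: indicator_def)
  then show ?thesis
    using assms(2) by (simp add: nn_integral_cmult_indicator)
qed

text \<open>The means over shrinking intervals converge to the values at the centres.\<close>

lemma le_if_small_interval_integrals_le:
  fixes f :: "real \<Rightarrow> real"
  assumes cont: "isCont f a" "isCont f b" and nonneg: "\<And>x. 0 \<le> f x" and "0 < r"
    and le: "\<And>d. 0 < d \<Longrightarrow> d < r \<Longrightarrow> (\<integral>\<^sup>+x\<in>{a - d..a + d}. ennreal (f x) \<partial>lebesgue)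
               \<le> (\<integral>\<^sup>+x\<in>{b - d..b + d}. ennreal (f x) \<partial>lebesgue)"
  shows "f a \<le> f b"
proof (rule ccontr)
  assume "\<not> f a \<le> f b"
  then obtain l m where lm: "f b < l" "l < m" "m < f a"
    by (meson dense not_le)
  have "eventually (\<lambda>x. m < f x) (nhds a)" "eventually (\<lambda>x. f x < l) (nhds b)"
    using cont lm by (auto simp: isCont_def eventually_nhds_conv_at order_tendstoD)
  then obtain d1 d2 where d12: "0 < d1" "\<And>x. dist x a < d1 \<Longrightarrow> m < f x"
      "0 < d2" "\<And>x. dist x b < d2 \<Longrightarrow> f x < l"
    unfolding eventually_nhds_metric by blast
  define d where "d = min (min d1 d2) r / 2"
  have d: "0 < d" "d < d1" "d < d2" "d < r"
    using d12 \<open>0 < r\<close> by (auto simp: d_def min_def)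
  have "ennreal (m * (2 * d)) = ennreal m * emeasure lebesgue {a - d..a + d}"
    using d nonneg[of b] lm by (simp add: ennreal_mult)
  also have "\<dots> \<le> (\<integral>\<^sup>+x\<in>{a - d..a + d}. ennreal (f x) \<partial>lebesgue)"
    using d by (intro const_le_set_nn_integral)
      (auto intro!: ennreal_leI less_imp_le[OF d12(2)] simp: dist_real_def)
  also have "\<dots> \<le> (\<integral>\<^sup>+x\<in>{b - d..b + d}. ennreal (f x) \<partial>lebesgue)"
    using d by (intro le)
  also have "\<dots> \<le> ennreal l * emeasure lebesgue {b - d..b + d}"
    using d by (intro set_nn_integral_le_const)
      (auto intro!: ennreal_leI less_imp_le[OF d12(4)] simp: dist_real_def)
  also have "\<dots> = ennreal (l * (2 * d))"
    using d nonneg[of b] lm by (simp add: ennreal_mult)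
  finally have "m * (2 * d) \<le> l * (2 * d)"
    using d nonneg[of b] lm by (subst (asm) ennreal_le_iff) auto
  then show False
    using d lm by simp
qed

theorem theorem1:
  fixes p :: "real \<Rightarrow> real"
  assumes "continuous_on {-1..1} p"
    and "\<forall>x\<in>{-1..1}. p x \<ge> 1"
    and "\<forall>u. piecewise_linear_on (-1) 1 u \<and> u \<in> W11_0 \<and> (\<forall>x\<in>{-1..1}. u x \<ge> 0)
           \<longrightarrow> J p (symmetrization u) \<le> J p u"
  shows "p constant_on {-1..1}"
proof -
  have isCont: "isCont p c" if "c \<in> {-1<..<1}" for c
    using assms(1) that by (intro continuous_on_interior[of "{-1..1}"]) auto
  have powr_le: "s powr p 0 \<le> s powr p c" if "0 < s" and c: "c \<in> {-1<..<1}" for s c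
  proof (rule le_if_small_interval_integrals_le[where f = "\<lambda>x. s powr p x" and r = "1 - \<bar>c\<bar>"])
    show "isCont (\<lambda>x. s powr p x) 0" "isCont (\<lambda>x. s powr p x) c"
      using \<open>0 < s\<close> c isCont by (auto intro!: continuous_intros)
    fix d :: real assume d: "0 < d" "d < 1 - \<bar>c\<bar>"
    then have tent: "piecewise_linear_on (-1) 1 (tent c d s)" "tent c d s \<in> W11_0"
      using \<open>0 < s\<close> by (auto intro!: piecewise_linear_on_tent tent_in_W11_0)
    have "J p (tent 0 d s) = J p (symmetrization (tent c d s))"
      using \<open>0 < s\<close> d by (subst symmetrization_tent) auto
    also have "\<dots> \<le> J p (tent c d s)"
      using assms(3) tent by (simp add: tent_def)
    finally show "(\<integral>\<^sup>+x\<in>{0 - d..0 + d}. ennreal (s powr p x) \<partial>lebesgue)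
        \<le> (\<integral>\<^sup>+x\<in>{c - d..c + d}. ennreal (s powr p x) \<partial>lebesgue)"
      using \<open>0 < s\<close> d by (simp add: J_tent)
  qed (use c in auto)
  have const: "p c = p 0" if "c \<in> {-1<..<1}" for c
  proof -
    have "(1 / 2) powr a = 2 powr - a" for a :: real
      by (simp add: powr_divide powr_minus_divide)
    then show ?thesis
      using powr_le[of 2 c] powr_le[of "1 / 2" c] that by simp
  qed
  have "p x = p 0" if "x \<in> {-1..1}" for x
  proof (rule continuous_constant_on_closure[where f = p and S = "{-1<..<1}"])
    show "continuous_on (closure {-1<..<1}) p" "x \<in> closure {-1<..<1}"
      using assms(1) that by simp_all
  qed (rule const)
  then show ?thesis
    unfolding constant_on_def by blast
qed

end
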